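(* Let $n \geq 1$ and let $\mathbb{F}_q$ be a finite field with $q$ elements. If $q = 2^m$ with $m \geq 2$, or if $q = 2$ and $n \geq 3$, then $\pi_q(\mathrm{Aff}_n(\mathbb{F}_q)) \subset \mathrm{Alt}(\mathbb{F}_q^n)$.
   Context: For a polynomial automorphism $F=(f_1,\ldots,f_n)$ over $\mathbb{F}_q$ (an $n$-tuple of polynomials in $\mathbb{F}_q[X_1,\ldots,X_n]$ invertible under composition), $\pi_q(F)$ is the permutation $x \mapsto (f_1(x),\ldots,f_n(x))$ of $\mathbb{F}_q^n$ it induces. $\mathrm{Aff}_n(\mathbb{F}_q)$ is the group of affine automorphisms, i.e. the polynomial automorphisms with $\deg f_i = 1$ for all $i$ (equivalently, maps $x \mapsto Ax + b$ with $A \in GL_n(\mathbb{F}_q)$, $b \in \mathbb{F}_q^n$). $\mathrm{Alt}(S)$ is the alternating group on a finite set $S$. *)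

theory Defs
  imports "HOL-Analysis.Determinants" "HOL-Library.Poly_Mapping" "HOL-Combinatorics.Permutations"
begin

text \<open>
  Polynomials in the variables \<open>X\<^sub>i\<close> (\<open>i :: 'n\<close>) over \<open>'a\<close>: finitely supported maps from
  exponent vectors to coefficients, with the convolution product of
  \<^theory>\<open>HOL-Library.Poly_Mapping\<close>.
\<close>

type_synonym ('n, 'a) mpoly = "('n \<Rightarrow>\<^sub>0 nat) \<Rightarrow>\<^sub>0 'a"

definition mvar :: "'n \<Rightarrow> ('n, 'a::comm_semiring_1) mpoly" where
  "mvar i = Poly_Mapping.single (Poly_Mapping.single i 1) 1"

definition mconst :: "'a::comm_semiring_1 \<Rightarrow> ('n, 'a) mpoly" where
  "mconst c = Poly_Mapping.single 0 c"

text \<open>Total degree, with the convention that the zero polynomial has degree \<open>0\<close>.\<close>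

definition total_degree :: "('n::finite, 'a::zero) mpoly \<Rightarrow> nat" where
  "total_degree p =
     Max (insert 0 ((\<lambda>m. \<Sum>i\<in>UNIV. Poly_Mapping.lookup m i) ` Poly_Mapping.keys p))"

definition eval_mpoly :: "('n::finite, 'a::comm_semiring_1) mpoly \<Rightarrow> 'a ^ 'n \<Rightarrow> 'a" where
  "eval_mpoly p x =
     (\<Sum>m\<in>Poly_Mapping.keys p.
        Poly_Mapping.lookup p m * (\<Prod>i\<in>UNIV. (x $ i) ^ Poly_Mapping.lookup m i))"

text \<open>Formal substitution \<open>p(g\<^sub>1, \<dots>, g\<^sub>n)\<close>; the result is again a polynomial.\<close>

definition subst_mpoly ::
  "('n::finite, 'a::comm_semiring_1) mpoly \<Rightarrow> (('n, 'a) mpoly) ^ 'n \<Rightarrow> ('n, 'a) mpoly" where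
  "subst_mpoly p G =
     (\<Sum>m\<in>Poly_Mapping.keys p.
        mconst (Poly_Mapping.lookup p m) * (\<Prod>i\<in>UNIV. (G $ i) ^ Poly_Mapping.lookup m i))"

definition comp_endo ::
  "(('n::finite, 'a::comm_semiring_1) mpoly) ^ 'n \<Rightarrow> (('n, 'a) mpoly) ^ 'n \<Rightarrow> (('n, 'a) mpoly) ^ 'n"
  where "comp_endo F G = (\<chi> i. subst_mpoly (F $ i) G)"

definition id_endo :: "(('n::finite, 'a::comm_semiring_1) mpoly) ^ 'n" where
  "id_endo = (\<chi> i. mvar i)"

text \<open>
  Invertibility is required of the tuple of formal polynomials, which over a finite ring is
  stronger than bijectivity of the induced map.
\<close>

definition poly_automorphism :: "(('n::finite, 'a::comm_semiring_1) mpoly) ^ 'n \<Rightarrow> bool" where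
  "poly_automorphism F \<longleftrightarrow> (\<exists>G. comp_endo F G = id_endo \<and> comp_endo G F = id_endo)"

definition Aff :: "((('n::finite, 'a::comm_semiring_1) mpoly) ^ 'n) set" where
  "Aff = {F. poly_automorphism F \<and> (\<forall>i. total_degree (F $ i) = 1)}"

definition induced_map ::
  "(('n::finite, 'a::comm_semiring_1) mpoly) ^ 'n \<Rightarrow> 'a ^ 'n \<Rightarrow> 'a ^ 'n" where
  "induced_map F x = (\<chi> i. eval_mpoly (F $ i) x)"

definition Alt :: "'b set \<Rightarrow> ('b \<Rightarrow> 'b) set" where
  "Alt S = {p. p permutes S \<and> evenperm p}"

end

theory Submission
  imports Defs
begin

text \<open>
  An element of \<open>Aff\<close> induces a map \<open>x \<mapsto> L x + b\<close> with \<open>L\<close> linear and bijective. Gaussian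
  elimination writes \<open>L\<close> as a product of maps \<open>x \<mapsto> x + x\<^sub>k v\<close>. In characteristic 2 each such map,
  and each translation, is even without any cycle count: it is the square of a permutation, or,
  for \<open>q \<ge> 4\<close>, a product of two permutations conjugate to each other.
\<close>

section \<open>Evaluation of polynomials\<close>

lemma eval_mpoly_superset:
  assumes "finite S" "Poly_Mapping.keys p \<subseteq> S"
  shows "eval_mpoly p x =
    (\<Sum>m\<in>S. Poly_Mapping.lookup p m * (\<Prod>i\<in>UNIV. (x $ i) ^ Poly_Mapping.lookup m i))"
  unfolding eval_mpoly_def using assms
  by (intro sum.mono_neutral_left) (auto simp: in_keys_iff)

lemma eval_mpoly_0 [simp]: "eval_mpoly 0 x = 0"
  by (simp add: eval_mpoly_def)

lemma eval_mpoly_single [simp]: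
  "eval_mpoly (Poly_Mapping.single m c) x = c * (\<Prod>i\<in>UNIV. (x $ i) ^ Poly_Mapping.lookup m i)"
  by (subst eval_mpoly_superset[of "{m}"]) auto

lemma eval_mpoly_add [simp]: "eval_mpoly (p + r) x = eval_mpoly p x + eval_mpoly r x"
proof -
  let ?S = "Poly_Mapping.keys p \<union> Poly_Mapping.keys r"
  have "Poly_Mapping.keys (p + r) \<subseteq> ?S" by (rule keys_add)
  then show ?thesis
    by (simp add: eval_mpoly_superset[of ?S] lookup_add distrib_right sum.distrib)
qed

text \<open>\<open>update_induct\<close> only updates at a key absent from \<open>f\<close>, and
  there an update is the addition of a single term. In this additive form, identities that are
  additive in \<open>p\<close> reduce to monomials.\<close>

lemma poly_mapping_single_induct [case_names zero add]:
  fixes p :: "'m \<Rightarrow>\<^sub>0 'b::comm_monoid_add"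
  assumes "P 0" and "\<And>f m c. P f \<Longrightarrow> P (f + Poly_Mapping.single m c)"
  shows "P p"
proof (induction p rule: update_induct)
  case (update f m c)
  have "Poly_Mapping.update m c f = f + Poly_Mapping.single m c"
    using update.hyps(1)
    by (intro poly_mapping_eqI)
      (auto simp: lookup_update lookup_add lookup_single in_keys_iff when_def)
  with assms(2)[OF update.IH] show ?case by simp
qed (rule assms(1))

text \<open>Both sides are additive in each factor, so an induction on \<open>p\<close> and one on
  \<open>r\<close> leave two monomials, whose exponents add.\<close>

lemma eval_mpoly_mult [simp]: "eval_mpoly (p * r) x = eval_mpoly p x * eval_mpoly r x"
proof (induction p rule: poly_mapping_single_induct)
  case (add f m c)
  have "eval_mpoly (Poly_Mapping.single m c * r) x =
      eval_mpoly (Poly_Mapping.single m c) x * eval_mpoly r x"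
  proof (induction r rule: poly_mapping_single_induct)
    case (add g l d)
    then show ?case
      by (simp add: distrib_left mult_single lookup_add power_add prod.distrib mult_ac)
  qed simp
  with add show ?case by (simp add: distrib_right)
qed simp

lemma eval_mpoly_1 [simp]: "eval_mpoly 1 x = 1"
  using eval_mpoly_single[of 0 1 x] by simp

lemma eval_mpoly_mconst [simp]: "eval_mpoly (mconst c) x = c"
  by (simp add: mconst_def)

lemma eval_mpoly_mvar [simp]: "eval_mpoly (mvar i) x = x $ i"
proof -
  have "(x $ j) ^ Poly_Mapping.lookup (Poly_Mapping.single i 1) j = (if j = i then x $ j else 1)"
    for j by (auto simp: lookup_single)
  then show ?thesis unfolding mvar_def eval_mpoly_single by simp
qed

lemma eval_mpoly_sum [simp]: "eval_mpoly (sum f A) x = (\<Sum>a\<in>A. eval_mpoly (f a) x)"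
  by (induction A rule: infinite_finite_induct) auto

lemma eval_mpoly_prod [simp]: "eval_mpoly (prod f A) x = (\<Prod>a\<in>A. eval_mpoly (f a) x)"
  by (induction A rule: infinite_finite_induct) auto

lemma eval_mpoly_power [simp]: "eval_mpoly (p ^ k) x = eval_mpoly p x ^ k"
  by (induction k) auto

lemma eval_mpoly_subst: "eval_mpoly (subst_mpoly p G) x = eval_mpoly p (induced_map G x)"
  by (simp add: subst_mpoly_def induced_map_def eval_mpoly_def[of p])

lemma induced_map_comp: "induced_map (comp_endo F G) x = induced_map F (induced_map G x)"
  unfolding induced_map_def[of F] induced_map_def[of "comp_endo F G"]
  by (simp add: comp_endo_def eval_mpoly_subst)

lemma induced_map_id: "induced_map id_endo x = x"
  by (simp add: induced_map_def id_endo_def)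

lemma bij_induced_map:
  assumes "poly_automorphism F"
  shows "bij (induced_map F)"
proof -
  obtain G where "comp_endo F G = id_endo" "comp_endo G F = id_endo"
    using assms by (auto simp: poly_automorphism_def)
  then show ?thesis
    by (intro o_bij[of "induced_map G"]) (auto simp: fun_eq_iff induced_map_id
        simp flip: induced_map_comp)
qed

section \<open>Polynomials of degree at most one\<close>

text \<open>Exponents with sum at most 1 are all zero or a single 1. Each case quantifies over
  \<open>x\<close>, so that one case split rewrites the monomial at several points at once.\<close>

lemma monomial_degree_le_1_cases:
  fixes m :: "'n::finite \<Rightarrow>\<^sub>0 nat"
  assumes "(\<Sum>i\<in>UNIV. Poly_Mapping.lookup m i) \<le> 1"
  obtains "\<And>x :: 'a::comm_semiring_1 ^ 'n. (\<Prod>i\<in>UNIV. (x $ i) ^ Poly_Mapping.lookup m i) = 1"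
  | k where
    "\<And>x :: 'a::comm_semiring_1 ^ 'n. (\<Prod>i\<in>UNIV. (x $ i) ^ Poly_Mapping.lookup m i) = x $ k"
proof (cases "m = 0")
  case True
  then show ?thesis using that(1) by simp
next
  case False
  then obtain k where k: "Poly_Mapping.lookup m k \<noteq> 0"
    by (metis poly_mapping_eqI lookup_zero)
  have s: "(\<Sum>i\<in>UNIV. Poly_Mapping.lookup m i) =
      Poly_Mapping.lookup m k + (\<Sum>i\<in>UNIV - {k}. Poly_Mapping.lookup m i)"
    by (simp add: sum.remove)
  have k1: "Poly_Mapping.lookup m k = 1" using s k assms by linarith
  have "(\<Sum>i\<in>UNIV - {k}. Poly_Mapping.lookup m i) = 0" using s k assms by linarith
  then have "Poly_Mapping.lookup m i = (if i = k then 1 else 0)" for i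
    using k1 by auto
  then have "(x $ i) ^ Poly_Mapping.lookup m i = (if i = k then x $ i else 1)"
    for x :: "'a ^ 'n" and i by simp
  then show ?thesis using that(2)[of k] by simp
qed

lemma degree_monomial_le_total_degree:
  assumes "m \<in> Poly_Mapping.keys p"
  shows "(\<Sum>i\<in>UNIV. Poly_Mapping.lookup m i) \<le> total_degree p"
  unfolding total_degree_def using assms by (intro Max_ge) auto

text \<open>The term at \<open>0\<close> balances the constant coefficient, so the identity holds
  monomial by monomial and no constant part has to be split off.\<close>

lemma eval_mpoly_affine_add:
  fixes p :: "('n::finite, 'a::comm_ring_1) mpoly"
  assumes "total_degree p \<le> 1"
  shows "eval_mpoly p (x + y) + eval_mpoly p 0 = eval_mpoly p x + eval_mpoly p y"
  unfolding eval_mpoly_def sum.distrib[symmetric]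
proof (intro sum.cong refl)
  fix m assume "m \<in> Poly_Mapping.keys p"
  then have "(\<Sum>i\<in>UNIV. Poly_Mapping.lookup m i) \<le> 1"
    using degree_monomial_le_total_degree assms order_trans by blast
  then show "Poly_Mapping.lookup p m * (\<Prod>i\<in>UNIV. ((x + y) $ i) ^ Poly_Mapping.lookup m i) +
      Poly_Mapping.lookup p m * (\<Prod>i\<in>UNIV. ((0::'a^'n) $ i) ^ Poly_Mapping.lookup m i) =
      Poly_Mapping.lookup p m * (\<Prod>i\<in>UNIV. (x $ i) ^ Poly_Mapping.lookup m i) +
      Poly_Mapping.lookup p m * (\<Prod>i\<in>UNIV. (y $ i) ^ Poly_Mapping.lookup m i)"
    by (rule monomial_degree_le_1_cases[where 'a = 'a])
      (simp_all only:, simp_all add: algebra_simps)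
qed

lemma eval_mpoly_affine_scale:
  fixes p :: "('n::finite, 'a::comm_ring_1) mpoly"
  assumes "total_degree p \<le> 1"
  shows "eval_mpoly p (c *s x) = c * eval_mpoly p x + (1 - c) * eval_mpoly p 0"
  unfolding eval_mpoly_def sum_distrib_left sum.distrib[symmetric]
proof (intro sum.cong refl)
  fix m assume "m \<in> Poly_Mapping.keys p"
  then have "(\<Sum>i\<in>UNIV. Poly_Mapping.lookup m i) \<le> 1"
    using degree_monomial_le_total_degree assms order_trans by blast
  then show "Poly_Mapping.lookup p m * (\<Prod>i\<in>UNIV. ((c *s x) $ i) ^ Poly_Mapping.lookup m i) =
      c * (Poly_Mapping.lookup p m * (\<Prod>i\<in>UNIV. (x $ i) ^ Poly_Mapping.lookup m i)) +
      (1 - c) *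
        (Poly_Mapping.lookup p m * (\<Prod>i\<in>UNIV. ((0::'a^'n) $ i) ^ Poly_Mapping.lookup m i))"
    by (rule monomial_degree_le_1_cases[where 'a = 'a])
      (simp_all only:, simp_all add: algebra_simps)
qed

lemma linear_induced_map_diff:
  fixes F :: "(('n::finite, 'a::field) mpoly) ^ 'n"
  assumes "\<And>i. total_degree (F $ i) \<le> 1"
  shows "Vector_Spaces.linear (*s) (*s) (\<lambda>x. induced_map F x - induced_map F 0)"
proof -
  have "eval_mpoly (F $ i) (x + y) - eval_mpoly (F $ i) 0 =
      (eval_mpoly (F $ i) x - eval_mpoly (F $ i) 0) + (eval_mpoly (F $ i) y - eval_mpoly (F $ i) 0)"
    for i x y using eval_mpoly_affine_add[OF assms, of i x y] by (simp add: algebra_simps)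
  moreover have "eval_mpoly (F $ i) (c *s x) - eval_mpoly (F $ i) 0 =
      c * (eval_mpoly (F $ i) x - eval_mpoly (F $ i) 0)" for i c x
    using eval_mpoly_affine_scale[OF assms, of i c x] by (simp add: algebra_simps)
  ultimately show ?thesis
    by (simp add: Vector_Spaces.linear_iff vec.vector_space_axioms vec_eq_iff induced_map_def)
qed

section \<open>Parity of permutations of a finite type\<close>

lemma evenperm_comp_bij:
  fixes f g :: "'b::finite \<Rightarrow> 'b"
  assumes "bij f" "bij g"
  shows "evenperm (f \<circ> g) \<longleftrightarrow> evenperm f = evenperm g"
  using assms by (intro evenperm_comp) (auto simp: permutation)

text \<open>A square has even parity. Bijectivity is asked of \<open>g\<close> alone: the root
  \<open>f\<close> inherits injectivity from it, and finiteness does the rest.\<close>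

lemma evenperm_if_square:
  fixes f :: "'b::finite \<Rightarrow> 'b"
  assumes "bij g" "\<And>x. f (f x) = g x"
  shows "evenperm g"
proof -
  have g: "f \<circ> f = g" using assms(2) by auto
  have "inj f" using assms by (metis bij_is_inj injI injD)
  then have "bij f" by (simp add: bij_def finite_UNIV_inj_surj)
  then show ?thesis using evenperm_comp_bij[of f f] g by simp
qed

lemma evenperm_conjugate:
  fixes f g h :: "'b::finite \<Rightarrow> 'b"
  assumes "bij f" "bij g" "bij h" "\<And>x. h (f x) = g (h x)"
  shows "evenperm f \<longleftrightarrow> evenperm g"
proof -
  have "h \<circ> f = g \<circ> h" using assms(4) by auto
  then show ?thesis
    using evenperm_comp_bij[of h f] evenperm_comp_bij[of g h] assms by auto
qed

section \<open>Linear maps, translations and shears\<close>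

lemma bij_translation: "bij (\<lambda>x::'a::field ^ 'n. x + b)"
  by (intro o_bij[of "\<lambda>x. x - b"]) auto

text \<open>The map multiplies the \<open>k\<close>-th coordinate by \<open>1 + v $ k\<close>, so
  \<open>x $ k\<close>, and then \<open>x\<close>, can be recovered. Transvections are the case
  \<open>v $ k = 0\<close>.\<close>

lemma bij_coordinate_shear:
  fixes v :: "'a::{field, finite} ^ 'n::finite"
  assumes "1 + v $ k \<noteq> 0"
  shows "bij (\<lambda>x. x + x $ k *s v)"
proof -
  have "inj (\<lambda>x. x + x $ k *s v)"
  proof (rule injI)
    fix x y assume e: "x + x $ k *s v = y + y $ k *s v"
    then have "x $ k * (1 + v $ k) = y $ k * (1 + v $ k)"
      by (auto simp: vec_eq_iff algebra_simps dest: spec[of _ k])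
    with assms have "x $ k = y $ k" by simp
    with e show "x = y" by simp
  qed
  then show ?thesis by (simp add: bij_def finite_UNIV_inj_surj)
qed

lemma linear_coordinate_shear:
  "Vector_Spaces.linear (*s) (*s) (\<lambda>x::'a::field ^ 'n::finite. x + x $ k *s v)"
  by (simp add: Vector_Spaces.linear_iff vec.vector_space_axioms vec_eq_iff algebra_simps)

lemma linear_fixes_span_axes:
  fixes f :: "'a::field ^ 'n::finite \<Rightarrow> 'a ^ 'n"
  assumes f: "Vector_Spaces.linear (*s) (*s) f"
    and "\<And>j. j \<notin> K \<Longrightarrow> f (axis j 1) = axis j 1" "\<And>j. j \<in> K \<Longrightarrow> x $ j = 0"
  shows "f x = x"
proof -
  interpret f: Vector_Spaces.linear "(*s)" "(*s)" f by (rule f)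
  have "f x = f (\<Sum>i\<in>UNIV. x $ i *s axis i 1)" by (simp add: basis_expansion)
  also have "\<dots> = (\<Sum>i\<in>UNIV. x $ i *s f (axis i 1))" by (simp add: f.sum f.scale)
  also have "\<dots> = (\<Sum>i\<in>UNIV. x $ i *s axis i 1)"
    using assms(2,3) by (intro sum.cong refl) (metis vector_smult_lzero)
  finally show ?thesis by (simp add: basis_expansion)
qed

text \<open>With three coordinates there is an index \<open>m\<close> besides \<open>k\<close> and
  an index \<open>l\<close> where \<open>v\<close> is nonzero. Subtracting a multiple of the
  \<open>l\<close>-th coordinate from the \<open>m\<close>-th kills \<open>v\<close> and keeps the
  value 1 on the \<open>m\<close>-th axis vector.\<close>

lemma exists_functional:
  fixes v :: "'a::field ^ 'n::finite"
  assumes "CARD('n) \<ge> 3" "v \<noteq> 0"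
  obtains \<psi> :: "'a::field ^ 'n::finite \<Rightarrow> 'a" and u where
    "\<And>x y. \<psi> (x + y) = \<psi> x + \<psi> y" "\<And>c x. \<psi> (c *s x) = c * \<psi> x" "\<psi> v = 0" "\<psi> u = 1" "u $ k = 0"
proof -
  obtain l where l: "v $ l \<noteq> 0" using assms(2) by (auto simp: vec_eq_iff)
  have "card {k, l} \<le> 2" by (simp add: card_insert_if)
  then have "{k, l} \<noteq> (UNIV :: 'n set)" using assms(1) by auto
  then obtain m where m: "m \<noteq> k" "m \<noteq> l" by auto
  show ?thesis
    using l m by (intro that[of "\<lambda>x. x $ m - (v $ m / v $ l) * x $ l" "axis m 1"])
      (auto simp: algebra_simps add_divide_distrib axis_def)
qed

section \<open>Characteristic two\<close>

text \<open>The sum of all field elements is unchanged when each is shifted by 1, so the field size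
  is zero in the field.\<close>

lemma two_eq_0_if_card_power2:
  assumes "CARD('a::{field, finite}) = 2 ^ m"
  shows "(2::'a) = 0"
proof -
  have "(\<Sum>x\<in>(UNIV::'a set). x + 1) = (\<Sum>x\<in>UNIV. x)"
    by (rule sum.reindex_bij_witness[of _ "\<lambda>x. x - 1" "\<lambda>x. x + 1"]) auto
  then have "of_nat CARD('a) = (0::'a)"
    by (simp add: sum.distrib)
  then show ?thesis using assms by simp
qed

lemma add_self_vec:
  fixes v :: "'a::field ^ 'n"
  assumes "(2::'a) = 0"
  shows "v + v = 0"
  using assms by (simp add: vec_eq_iff flip: mult_2)

text \<open>Squaring is injective in characteristic 2, hence surjective on a finite field.\<close>

lemma exists_square_root_char2:
  fixes c :: "'a::{field, finite}"
  assumes "(2::'a) = 0"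
  shows "\<exists>a. a * a = c"
proof -
  have "inj (\<lambda>a::'a. a * a)"
  proof (rule injI)
    fix a b :: 'a assume "a * a = b * b"
    then have "(a - b) * (a - b) = 2 * (b * b - a * b)" by (simp add: algebra_simps)
    then show "a = b" using assms by simp
  qed
  then show ?thesis by (metis finite_UNIV_inj_surj finite surjD)
qed

lemma exists_not_0_1:
  assumes "CARD('a::{field, finite}) > 2"
  obtains s :: "'a::{field, finite}" where "s \<noteq> 0" "s \<noteq> 1"
proof -
  have "card {0, 1::'a} = 2" by simp
  then have "{0, 1::'a} \<noteq> UNIV" using assms by (metis less_irrefl)
  then show ?thesis using that by auto
qed

section \<open>Parity of translations and coordinate shears\<close>

context
  assumes char2: "(2::'a::{field, finite}) = 0"
    and size: "CARD('a) > 2 \<or> CARD('n::finite) \<ge> 3"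
begin

lemma evenperm_translation: "evenperm (\<lambda>x::'a ^ 'n. x + b)"
proof (cases "CARD('a) > 2")
  case True
  then obtain s :: 'a where s: "s \<noteq> 0" "s \<noteq> 1" by (rule exists_not_0_1)
  have s1: "1 + s \<noteq> 0" using s char2 by (metis add_left_cancel one_add_one)
  \<comment> \<open>Chosen so that \<open>a + s *s a = b\<close>; the translations by
    \<open>a\<close> and \<open>s *s a\<close> are conjugate under scaling by
    \<open>s\<close>.\<close>
  define a where "a = inverse (1 + s) *s b"
  have bs: "bij (\<lambda>x::'a ^ 'n. s *s x)"
    using s by (intro o_bij[of "\<lambda>x. inverse s *s x"]) (auto simp: vec.scale_scale)
  have "evenperm (\<lambda>x. x + a) \<longleftrightarrow> evenperm (\<lambda>x. x + s *s a)"
    by (rule evenperm_conjugate[OF _ _ bs])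
      (auto simp: bij_translation vec.scale_right_distrib)
  moreover have "a + s *s a = b"
  proof -
    have "a + s *s a = (1 + s) *s a" by (simp add: vec.scale_left_distrib)
    also have "\<dots> = b" using s1 by (simp add: a_def vec.scale_scale)
    finally show ?thesis .
  qed
  then have "(\<lambda>x. x + b) = (\<lambda>x. x + s *s a) \<circ> (\<lambda>x. x + a)"
    by (auto simp: fun_eq_iff add.assoc)
  ultimately show ?thesis
    using evenperm_comp_bij[OF bij_translation[of "s *s a"] bij_translation[of a]] by simp
next
  case False
  with size have n: "CARD('n) \<ge> 3" by simp
  show ?thesis
  proof (cases "b = 0")
    case True
    then show ?thesis by simp
  next
    case False
    then obtain \<psi> :: "'a ^ 'n \<Rightarrow> 'a" and u where
      \<psi>: "\<And>x y. \<psi> (x + y) = \<psi> x + \<psi> y" "\<And>c x. \<psi> (c *s x) = c * \<psi> x" "\<psi> b = 0" "\<psi> u = 1"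
      using exists_functional[OF n, of b] by metis
    \<comment> \<open>\<open>?f\<close> raises \<psi> by 1, so two applications add \<open>b\<close>
      with total coefficient \<psi> x + (\<psi> x + 1) = 1, and the two copies of \<open>u\<close>
      cancel.\<close>
    let ?f = "\<lambda>x. x + \<psi> x *s b + u"
    have "?f (?f x) = x + b" for x
    proof -
      have "?f (?f x) = x + (\<psi> x *s b + \<psi> x *s b) + (u + u) + b"
        by (simp add: \<psi> vec.scale_left_distrib add_ac)
      then show ?thesis by (simp add: add_self_vec[OF char2])
    qed
    then show ?thesis by (rule evenperm_if_square[OF bij_translation])
  qed
qed

lemma evenperm_coordinate_shear:
  fixes v :: "'a ^ 'n"
  assumes "1 + v $ k \<noteq> 0"
  shows "evenperm (\<lambda>x. x + x $ k *s v)"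
proof (cases "v $ k = 0")
  case False
  \<comment> \<open>Applying \<open>?f\<close> twice adds
    \<open>(2 * a + a * a * v $ k) * x $ k\<close> times \<open>v\<close>; this choice of
    \<open>a\<close> makes the bracket 1.\<close>
  obtain a where a: "a * a = inverse (v $ k)" using exists_square_root_char2[OF char2] by blast
  let ?f = "\<lambda>x. x + (a * x $ k) *s v"
  have "?f (?f x) = x + x $ k *s v" for x
  proof -
    have "a * (a * x $ k * v $ k) = (a * a) * v $ k * x $ k" by (simp add: mult_ac)
    also have "\<dots> = x $ k" using False a by simp
    finally have "?f (?f x) = x + ((a * x $ k) *s v + (a * x $ k) *s v) + x $ k *s v"
      by (simp add: vec.scale_left_distrib distrib_left add_ac)
    then show ?thesis by (simp add: add_self_vec[OF char2])
  qed
  then show ?thesis by (rule evenperm_if_square[OF bij_coordinate_shear[OF assms]])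
next
  case vk: True
  show ?thesis
  proof (cases "CARD('a) > 2")
    case True
    then obtain s :: 'a where s: "s \<noteq> 0" "s \<noteq> 1" by (rule exists_not_0_1)
    have s1: "1 + s \<noteq> 0" using s char2 by (metis add_left_cancel one_add_one)
    define w where "w = inverse (1 + s) *s v"
    have wk: "w $ k = 0" using vk by (simp add: w_def)
    let ?T = "\<lambda>c x. x + x $ k *s (c *s w)"
    have bT: "bij (?T c)" for c using wk by (intro bij_coordinate_shear) simp
    \<comment> \<open>\<open>?h\<close> multiplies the \<open>k\<close>-th coordinate by
      \<open>s\<close> and fixes the others. Since \<open>w $ k = 0\<close>, it fixes
      \<open>w\<close> and conjugates \<open>?T s\<close> to \<open>?T 1\<close>.\<close>
    let ?h = "\<lambda>x. x + x $ k *s ((s - 1) *s axis k 1)"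
    have bh: "bij ?h" using s by (intro bij_coordinate_shear) (simp add: axis_def)
    have "evenperm (?T s) \<longleftrightarrow> evenperm (?T 1)"
      by (rule evenperm_conjugate[OF bT bT bh])
        (auto simp: wk vec_eq_iff axis_def algebra_simps)
    moreover have "w + s *s w = v"
    proof -
      have "w + s *s w = (1 + s) *s w" by (simp add: vec.scale_left_distrib)
      also have "\<dots> = v" using s1 by (simp add: w_def vec.scale_scale)
      finally show ?thesis .
    qed
    then have "(\<lambda>x. x + x $ k *s v) = ?T s \<circ> ?T 1"
      by (auto simp: fun_eq_iff wk vec.scale_right_distrib add_ac)
    ultimately show ?thesis
      using evenperm_comp_bij[OF bT[of s] bT[of 1]] by simp
  next
    case False
    with size have n: "CARD('n) \<ge> 3" by simp
    show ?thesis
    proof (cases "v = 0")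
      case True
      then show ?thesis by simp
    next
      case False
      then obtain \<psi> :: "'a ^ 'n \<Rightarrow> 'a" and u where
        \<psi>: "\<And>x y. \<psi> (x + y) = \<psi> x + \<psi> y" "\<And>c x. \<psi> (c *s x) = c * \<psi> x" "\<psi> v = 0" "\<psi> u = 1"
          "u $ k = 0"
        using exists_functional[OF n, of v k] by metis
      \<comment> \<open>The commutator of the transvections \<open>x \<mapsto> x + x\<^sub>k u\<close> and \<open>x \<mapsto> x + \<psi> x v\<close>; both are
        involutions, so it is the square of their product.\<close>
      define f where "f = (\<lambda>x. x + \<psi> x *s v + x $ k *s u)"
      have "f (f x) = x + x $ k *s v" for x
      proof -
        have "f (f x) = x + (\<psi> x *s v + \<psi> x *s v) + (x $ k *s u + x $ k *s u) + x $ k *s v"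
          by (simp add: f_def \<psi> vk vec.scale_left_distrib add_ac)
        then show ?thesis by (simp add: add_self_vec[OF char2])
      qed
      then show ?thesis by (rule evenperm_if_square[OF bij_coordinate_shear[OF assms]])
    qed
  qed
qed

section \<open>Gaussian elimination\<close>

text \<open>\<open>K\<close> contains every axis that \<open>f\<close> may still move. Composing
  with even shears makes one more axis fixed and keeps the parity, so induction on \<open>K\<close>
  ends at the identity.\<close>

lemma evenperm_linear_if_fixes_axes:
  fixes f :: "'a ^ 'n \<Rightarrow> 'a ^ 'n"
  assumes "finite K" "Vector_Spaces.linear (*s) (*s) f" "bij f"
    and "\<And>j. j \<notin> K \<Longrightarrow> f (axis j 1) = axis j 1"
  shows "evenperm f"
  using assms
proof (induction K arbitrary: f rule: finite_induct)
  case empty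
  have "f x = x" for x
    using linear_fixes_span_axes[OF empty.prems(1), of "{}"] empty.prems(3) by auto
  then have "f = id" by auto
  then show ?case by simp
next
  case (insert k K)
  \<comment> \<open>The step with nonzero pivot, stated for any \<open>g\<close> because it is
    applied to \<open>f\<close> itself or to \<open>f\<close> followed by a shear that creates the
    pivot.\<close>
  have clear: "evenperm g"
    if g: "Vector_Spaces.linear (*s) (*s) g" "bij g"
      "\<And>j. j \<notin> insert k K \<Longrightarrow> g (axis j 1) = axis j 1"
      and pivot: "g (axis k 1) $ k \<noteq> 0" for g :: "'a ^ 'n \<Rightarrow> 'a ^ 'n"
  proof -
    define w where "w = g (axis k 1)"
    \<comment> \<open>The solution of \<open>w + w $ k *s v = axis k 1\<close>. It gives
      \<open>1 + v $ k = inverse (w $ k)\<close>, so the shear is bijective; it fixes every axis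
      other than \<open>k\<close>.\<close>
    define v where "v = (- inverse (w $ k)) *s (w - axis k 1)"
    have wk: "w $ k \<noteq> 0" using pivot by (simp add: w_def)
    let ?S = "\<lambda>x. x + x $ k *s v"
    have v: "1 + v $ k \<noteq> 0" using wk by (simp add: v_def axis_def field_simps)
    have Sw: "?S w = axis k 1" using wk by (simp add: v_def vec.scale_scale)
    have "evenperm (?S \<circ> g)"
    proof (rule insert.IH)
      show "Vector_Spaces.linear (*s) (*s) (?S \<circ> g)"
        by (rule Vector_Spaces.linear_compose[OF g(1) linear_coordinate_shear])
      show "bij (?S \<circ> g)" by (intro bij_comp g bij_coordinate_shear v)
      fix j assume "j \<notin> K"
      show "(?S \<circ> g) (axis j 1) = axis j 1"
      proof (cases "j = k")
        case True
        then show ?thesis using Sw by (simp add: w_def)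
      next
        case False
        with \<open>j \<notin> K\<close> g(3) have "g (axis j 1) = axis j 1" by auto
        with False show ?thesis by (simp add: axis_def)
      qed
    qed
    then show ?thesis
      using evenperm_comp_bij[OF bij_coordinate_shear[OF v] g(2)]
        evenperm_coordinate_shear[OF v] by simp
  qed
  let ?w = "f (axis k 1)"
  show ?case
  proof (cases "?w $ k = 0")
    case False
    then show ?thesis using clear insert.prems by blast
  next
    case True
    \<comment> \<open>Otherwise \<open>?w\<close> is a combination of fixed axes, so
      \<open>f\<close> takes the same value at \<open>?w\<close> and \<open>axis k 1\<close>.
      Injectivity identifies them, against \<open>?w $ k = 0\<close>.\<close>
    have "\<exists>l\<in>insert k K. ?w $ l \<noteq> 0"
    proof (rule ccontr)
      assume "\<not> ?thesis"
      then have "f ?w = ?w"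
        using linear_fixes_span_axes[OF insert.prems(1), of "insert k K" ?w] insert.prems(3) by auto
      then have "?w = axis k 1" using insert.prems(2) by (meson bij_is_inj injD)
      then show False using True by (simp add: axis_def)
    qed
    with True obtain l where l: "l \<in> K" "?w $ l \<noteq> 0" by auto
    with insert.hyps have "l \<noteq> k" by auto
    \<comment> \<open>Adds the nonzero \<open>l\<close>-th coordinate to the zero
      \<open>k\<close>-th one, creating a pivot. As \<open>l\<close> lies in \<open>K\<close>, the
      axes outside \<open>insert k K\<close> stay fixed.\<close>
    let ?S = "\<lambda>x::'a ^ 'n. x + x $ l *s axis k 1"
    have v: "1 + axis k (1::'a) $ l \<noteq> 0" using \<open>l \<noteq> k\<close> by (simp add: axis_def)
    have "evenperm (?S \<circ> f)"
    proof (rule clear)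
      show "Vector_Spaces.linear (*s) (*s) (?S \<circ> f)"
        by (rule Vector_Spaces.linear_compose[OF insert.prems(1) linear_coordinate_shear])
      show "bij (?S \<circ> f)" by (intro bij_comp insert.prems bij_coordinate_shear v)
      show "(?S \<circ> f) (axis k 1) $ k \<noteq> 0" using True l by (simp add: axis_def)
      fix j assume "j \<notin> insert k K"
      then have "f (axis j 1) = axis j 1" "j \<noteq> l" using insert.prems(3) l by auto
      then show "(?S \<circ> f) (axis j 1) = axis j 1" by (simp add: axis_def)
    qed
    then show ?thesis
      using evenperm_comp_bij[OF bij_coordinate_shear[OF v] insert.prems(2)]
        evenperm_coordinate_shear[OF v] by simp
  qed
qed

lemma evenperm_affine:
  fixes f :: "'a ^ 'n \<Rightarrow> 'a ^ 'n"
  assumes "Vector_Spaces.linear (*s) (*s) (\<lambda>x. f x - f 0)" "bij f"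
  shows "evenperm f"
proof -
  let ?L = "\<lambda>x. f x - f 0"
  have "?L = (\<lambda>x. x + (- f 0)) \<circ> f" by auto
  then have L: "bij ?L" using bij_comp[OF assms(2) bij_translation[of "- f 0"]] by simp
  have f: "f = (\<lambda>x. x + f 0) \<circ> ?L" by auto
  have "evenperm ((\<lambda>x. x + f 0) \<circ> ?L)"
    using evenperm_comp_bij[OF bij_translation L] evenperm_translation
      evenperm_linear_if_fixes_axes[OF _ assms(1) L, of UNIV] by simp
  then show ?thesis using f by simp
qed

end

theorem corollary2:
  fixes q :: nat
  assumes "CARD('n::finite) \<ge> 1"
    and "CARD('a::{field, finite}) = q"
    and "(\<exists>m::nat. m \<ge> 2 \<and> q = 2 ^ m) \<or> (q = 2 \<and> CARD('n) \<ge> 3)"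
  shows "induced_map ` (Aff :: ((('n, 'a) mpoly) ^ 'n) set) \<subseteq> Alt (UNIV :: ('a ^ 'n) set)"
proof -
  obtain m where "q = 2 ^ m" using assms(3) by (metis power_one_right)
  then have char2: "(2::'a) = 0" using assms(2) by (intro two_eq_0_if_card_power2) simp
  have "q > 2" if "m \<ge> 2" "q = 2 ^ m" for m
    using power_increasing[of 2 m "2::nat"] that by simp
  then have size: "CARD('a) > 2 \<or> CARD('n) \<ge> 3" using assms(2,3) by auto
  show ?thesis
  proof (rule image_subsetI)
    fix F :: "(('n, 'a) mpoly) ^ 'n" assume "F \<in> Aff"
    then have F: "bij (induced_map F)" "\<And>i. total_degree (F $ i) \<le> 1"
      by (auto simp: Aff_def bij_induced_map)
    then have "evenperm (induced_map F)"
      by (intro evenperm_affine[OF char2 size] linear_induced_map_diff)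
    with F show "induced_map F \<in> Alt UNIV"
      by (auto simp: Alt_def intro!: bij_imp_permutes)
  qed
qed

end
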